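(* Let $2\le m\le n$ be integers and let $0\le b\le n-1$. A pattern $E\subseteq[m]\times[n]$ is correctable for the topology $T_{m\times n}(1,b,0)$ if and only if it is regular for $T_{m\times n}(1,b,0)$.
   Context: Notation: $[s]=\{1,\dots,s\}$. A code instantiating the topology $T_{m\times n}(1,b,0)$ over a field $\mathbb{F}$ of characteristic $2$ is specified by elements $\alpha_i\in\mathbb{F}$ ($i\in[m]$) and $\beta_j^{(k)}\in\mathbb{F}$ ($j\in[n],k\in[b]$); it is the linear code of all arrays $(x_{ij})\in\mathbb{F}^{m\times n}$ satisfying (1) $\sum_{i=1}^m\alpha_ix_{ij}=0$ for all $j\in[n]$; (2) $\sum_{j=1}^n\beta_j^{(k)}x_{ij}=0$ for all $i\in[m]$, $k\in[b]$. An erasure pattern is a set $E\subseteq[m]\times[n]$. A code corrects $E$ if the entries $x_{ij}$, $(i,j)\in E$, can be recovered from the remaining entries using the parity check equations, i.e. the only codeword supported inside $E$ is $0$. $E$ is correctable for the topology if some code instantiating the topology (over some field of characteristic $2$) corrects $E$. The pattern $E$ is regular for $T_{m\times n}(1,b,0)$ if for all $U\subseteq[m]$, $|U|=u\ge 1$, and all $V\subseteq[n]$, $|V|=v\ge b$, one has $|E\cap(U\times V)|\le v+ub-b$. *)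

theory Defs
  imports "HOL-Algebra.Algebra"
begin

definition char2_field :: "('a, 'r) ring_scheme \<Rightarrow> bool" where
  "char2_field F \<longleftrightarrow> field F \<and> \<one>\<^bsub>F\<^esub> \<oplus>\<^bsub>F\<^esub> \<one>\<^bsub>F\<^esub> = \<zero>\<^bsub>F\<^esub>"

text \<open>Coefficients are total functions; only their values at indices in range matter. The coefficient
  \<open>\<beta> k j\<close> is that of column \<open>j\<close> in the \<open>k\<close>-th row parity check.\<close>

definition coefficients ::
  "('a, 'r) ring_scheme \<Rightarrow> nat \<Rightarrow> nat \<Rightarrow> nat \<Rightarrow> (nat \<Rightarrow> 'a) \<Rightarrow> (nat \<Rightarrow> nat \<Rightarrow> 'a) \<Rightarrow> bool" where
  "coefficients F m n b \<alpha> \<beta> \<longleftrightarrow>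
     (\<forall>i\<in>{1..m}. \<alpha> i \<in> carrier F) \<and> (\<forall>k\<in>{1..b}. \<forall>j\<in>{1..n}. \<beta> k j \<in> carrier F)"

definition code ::
  "('a, 'r) ring_scheme \<Rightarrow> nat \<Rightarrow> nat \<Rightarrow> nat \<Rightarrow> (nat \<Rightarrow> 'a) \<Rightarrow> (nat \<Rightarrow> nat \<Rightarrow> 'a) \<Rightarrow> (nat \<times> nat \<Rightarrow> 'a) set" where
  "code F m n b \<alpha> \<beta> =
     {x \<in> {1..m} \<times> {1..n} \<rightarrow>\<^sub>E carrier F.
        (\<forall>j\<in>{1..n}. (\<Oplus>\<^bsub>F\<^esub>i\<in>{1..m}. \<alpha> i \<otimes>\<^bsub>F\<^esub> x (i, j)) = \<zero>\<^bsub>F\<^esub>) \<and>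
        (\<forall>i\<in>{1..m}. \<forall>k\<in>{1..b}. (\<Oplus>\<^bsub>F\<^esub>j\<in>{1..n}. \<beta> k j \<otimes>\<^bsub>F\<^esub> x (i, j)) = \<zero>\<^bsub>F\<^esub>)}"

definition corrects ::
  "('a, 'r) ring_scheme \<Rightarrow> nat \<Rightarrow> nat \<Rightarrow> (nat \<times> nat \<Rightarrow> 'a) set \<Rightarrow> (nat \<times> nat) set \<Rightarrow> bool" where
  "corrects F m n C E \<longleftrightarrow>
     (\<forall>x\<in>C. (\<forall>p\<in>{1..m} \<times> {1..n} - E. x p = \<zero>\<^bsub>F\<^esub>) \<longrightarrow> (\<forall>p\<in>{1..m} \<times> {1..n}. x p = \<zero>\<^bsub>F\<^esub>))"

text \<open>HOL cannot quantify over types inside a formula, so the existential over fields ranges over all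
  fields of characteristic 2 whose carrier is a subset of an explicitly given type \<open>'a\<close>. The notion
  is monotone in \<open>'a\<close> (lemma \<open>correctable_inj\<close>), so fields on a finite type are covered by any
  infinite one.\<close>

definition correctable :: "'a itself \<Rightarrow> nat \<Rightarrow> nat \<Rightarrow> nat \<Rightarrow> (nat \<times> nat) set \<Rightarrow> bool" where
  "correctable (_ :: 'a itself) m n b E \<longleftrightarrow>
     (\<exists>(F :: 'a ring) \<alpha> \<beta>. char2_field F \<and> coefficients F m n b \<alpha> \<beta> \<and>
        corrects F m n (code F m n b \<alpha> \<beta>) E)"

text \<open>As \<open>card U \<ge> 1\<close>, the subtraction on \<^typ>\<open>nat\<close> below does not truncate.\<close>

definition regular :: "nat \<Rightarrow> nat \<Rightarrow> nat \<Rightarrow> (nat \<times> nat) set \<Rightarrow> bool" where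
  "regular m n b E \<longleftrightarrow>
     (\<forall>U V. U \<subseteq> {1..m} \<longrightarrow> V \<subseteq> {1..n} \<longrightarrow> card U \<ge> 1 \<longrightarrow> card V \<ge> b \<longrightarrow>
        card (E \<inter> U \<times> V) \<le> card V + card U * b - b)"

lemma correctable_inj:
  fixes f :: "'a \<Rightarrow> 'b"
  assumes "inj f" and "correctable TYPE('a) m n b E"
  shows "correctable TYPE('b) m n b E"
proof -
  obtain F :: "'a ring" and \<alpha> \<beta> where F: "field F" "\<one>\<^bsub>F\<^esub> \<oplus>\<^bsub>F\<^esub> \<one>\<^bsub>F\<^esub> = \<zero>\<^bsub>F\<^esub>"
    and co: "coefficients F m n b \<alpha> \<beta>" and cor: "corrects F m n (code F m n b \<alpha> \<beta>) E"
    using assms(2) by (auto simp: correctable_def char2_field_def)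
  define G where "G = image_ring f F"
  interpret F: field F by fact
  have injF: "inj_on f (carrier F)" using assms(1) by (rule inj_on_subset) simp
  have G: "field G" unfolding G_def by (rule F.inj_imp_image_ring_is_field[OF injF])
  interpret G: field G by fact
  have iso: "f \<in> ring_iso F G" unfolding G_def by (rule inj_imp_image_ring_iso[OF injF])
  have hom: "f \<in> ring_hom F G" using iso by (auto simp: ring_iso_def)
  interpret h: ring_hom_ring F G f
    by (rule ring_hom_ringI2) (use hom F.ring_axioms G.ring_axioms in auto)
  have carr: "carrier G = f ` carrier F" using iso by (auto simp: ring_iso_def bij_betw_def)
  have G2: "\<one>\<^bsub>G\<^esub> \<oplus>\<^bsub>G\<^esub> \<one>\<^bsub>G\<^esub> = \<zero>\<^bsub>G\<^esub>"
    using F(2) h.hom_add[of "\<one>\<^bsub>F\<^esub>" "\<one>\<^bsub>F\<^esub>"] by simp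
  let ?a = "f \<circ> \<alpha>" and ?b = "\<lambda>k. f \<circ> \<beta> k"
  have coG: "coefficients G m n b ?a ?b"
    using co by (auto simp: coefficients_def carr)
  have zero: "f y = \<zero>\<^bsub>G\<^esub> \<longleftrightarrow> y = \<zero>\<^bsub>F\<^esub>" if "y \<in> carrier F" for y
    using assms(1) h.hom_zero by (metis injD)
  have "corrects G m n (code G m n b ?a ?b) E"
    unfolding corrects_def
  proof (intro ballI impI)
    fix x p
    assume x: "x \<in> code G m n b ?a ?b" and supp: "\<forall>p\<in>{1..m} \<times> {1..n} - E. x p = \<zero>\<^bsub>G\<^esub>"
      and p: "p \<in> {1..m} \<times> {1..n}"
    define y where "y = restrict (\<lambda>p. Hilbert_Choice.inv f (x p)) ({1..m} \<times> {1..n})"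
    have xc: "x q \<in> f ` carrier F" if "q \<in> {1..m} \<times> {1..n}" for q
      using x that by (auto simp: code_def carr)
    have y: "y q \<in> carrier F" "x q = f (y q)" if "q \<in> {1..m} \<times> {1..n}" for q
      using xc[OF that] that assms(1) by (auto simp: y_def)
    have b: "\<beta> k j \<in> carrier F" if "j \<in> {1..n}" "k \<in> {1..b}" for j k
      using co that by (auto simp: coefficients_def)
    have a: "\<alpha> i \<in> carrier F" if "i \<in> {1..m}" for i
      using co that by (auto simp: coefficients_def)
    have col: "(\<Oplus>\<^bsub>G\<^esub>i\<in>{1..m}. ?a i \<otimes>\<^bsub>G\<^esub> x (i, j)) = f (\<Oplus>\<^bsub>F\<^esub>i\<in>{1..m}. \<alpha> i \<otimes>\<^bsub>F\<^esub> y (i, j))"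
      if j: "j \<in> {1..n}" for j
    proof -
      have "f (\<Oplus>\<^bsub>F\<^esub>i\<in>{1..m}. \<alpha> i \<otimes>\<^bsub>F\<^esub> y (i, j)) =
            (\<Oplus>\<^bsub>G\<^esub>i\<in>{1..m}. (f \<circ> (\<lambda>i. \<alpha> i \<otimes>\<^bsub>F\<^esub> y (i, j))) i)"
        using h.hom_finsum[of "\<lambda>i. \<alpha> i \<otimes>\<^bsub>F\<^esub> y (i, j)" "{1..m}"] a y(1) j by (simp add: o_def)
      also have "\<dots> = (\<Oplus>\<^bsub>G\<^esub>i\<in>{1..m}. ?a i \<otimes>\<^bsub>G\<^esub> x (i, j))"
        by (rule G.finsum_cong') (use a y j in auto)
      finally show ?thesis ..
    qed
    have row: "(\<Oplus>\<^bsub>G\<^esub>j\<in>{1..n}. ?b k j \<otimes>\<^bsub>G\<^esub> x (i, j)) = f (\<Oplus>\<^bsub>F\<^esub>j\<in>{1..n}. \<beta> k j \<otimes>\<^bsub>F\<^esub> y (i, j))"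
      if i: "i \<in> {1..m}" "k \<in> {1..b}" for i k
    proof -
      have "f (\<Oplus>\<^bsub>F\<^esub>j\<in>{1..n}. \<beta> k j \<otimes>\<^bsub>F\<^esub> y (i, j)) =
            (\<Oplus>\<^bsub>G\<^esub>j\<in>{1..n}. (f \<circ> (\<lambda>j. \<beta> k j \<otimes>\<^bsub>F\<^esub> y (i, j))) j)"
        using h.hom_finsum[of "\<lambda>j. \<beta> k j \<otimes>\<^bsub>F\<^esub> y (i, j)" "{1..n}"] b y(1) i by (simp add: o_def)
      also have "\<dots> = (\<Oplus>\<^bsub>G\<^esub>j\<in>{1..n}. ?b k j \<otimes>\<^bsub>G\<^esub> x (i, j))"
        by (rule G.finsum_cong') (use b y i in auto)
      finally show ?thesis ..
    qed
    have "y \<in> code F m n b \<alpha> \<beta>"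
      unfolding code_def
    proof (intro CollectI conjI ballI)
      show "y \<in> {1..m} \<times> {1..n} \<rightarrow>\<^sub>E carrier F"
        using y(1) by (auto simp: y_def)
      show "(\<Oplus>\<^bsub>F\<^esub>i\<in>{1..m}. \<alpha> i \<otimes>\<^bsub>F\<^esub> y (i, j)) = \<zero>\<^bsub>F\<^esub>" if j: "j \<in> {1..n}" for j
      proof (subst zero[symmetric])
        show "(\<Oplus>\<^bsub>F\<^esub>i\<in>{1..m}. \<alpha> i \<otimes>\<^bsub>F\<^esub> y (i, j)) \<in> carrier F"
          by (rule F.finsum_closed) (use a y(1) j in auto)
        show "f (\<Oplus>\<^bsub>F\<^esub>i\<in>{1..m}. \<alpha> i \<otimes>\<^bsub>F\<^esub> y (i, j)) = \<zero>\<^bsub>G\<^esub>"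
          using x col[OF j] j by (auto simp: code_def)
      qed
      show "(\<Oplus>\<^bsub>F\<^esub>j\<in>{1..n}. \<beta> k j \<otimes>\<^bsub>F\<^esub> y (i, j)) = \<zero>\<^bsub>F\<^esub>" if i: "i \<in> {1..m}" "k \<in> {1..b}" for i k
      proof (subst zero[symmetric])
        show "(\<Oplus>\<^bsub>F\<^esub>j\<in>{1..n}. \<beta> k j \<otimes>\<^bsub>F\<^esub> y (i, j)) \<in> carrier F"
          by (rule F.finsum_closed) (use b y(1) i in auto)
        show "f (\<Oplus>\<^bsub>F\<^esub>j\<in>{1..n}. \<beta> k j \<otimes>\<^bsub>F\<^esub> y (i, j)) = \<zero>\<^bsub>G\<^esub>"
          using x row[OF i] i by (auto simp: code_def)
      qed
    qed
    moreover have "\<forall>q\<in>{1..m} \<times> {1..n} - E. y q = \<zero>\<^bsub>F\<^esub>"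
      using supp y zero by (metis DiffD1)
    ultimately have "y p = \<zero>\<^bsub>F\<^esub>"
      using cor p by (auto simp: corrects_def)
    then show "x p = \<zero>\<^bsub>G\<^esub>" using y(2)[OF p] by simp
  qed
  then show ?thesis
    using G G2 coG by (auto simp: correctable_def char2_field_def)
qed

end

theory Submission
  imports Defs "HOL-Library.Z2" "HOL-Library.Nat_Bijection" "HOL-Library.Countable_Set"
    "Jordan_Normal_Form.Determinant" "Jordan_Normal_Form.VS_Connect"
begin

text \<open>Necessity counts dimensions on \<open>U \<times> V\<close>: the column checks and row checks satisfy \<open>b\<close>
  linear relations, so only \<open>v + u * b - b\<close> of them matter, and more erasures than equations leave a
  nonzero codeword.

  For sufficiency take \<open>\<alpha> = 1\<close> and let \<open>\<beta>\<close> be a parity check matrix of the row space of a generic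
  \<open>(n - b) \<times> n\<close> matrix with prescribed supports: \<open>card (E `` {i}) - b\<close> rows supported in row \<open>i\<close> of
  \<open>E\<close> for each \<open>i\<close>, and unrestricted rows for the remainder. Regularity says that any \<open>s > 0\<close> of these
  supports cover at least \<open>s + b\<close> columns. By Hall's theorem the generators not belonging to \<open>i\<close> can be
  matched into the columns outside row \<open>i\<close> of \<open>E\<close>, and the corresponding generic minor is nonzero, so
  row \<open>i\<close> of a codeword supported in \<open>E\<close> is a combination of the generators belonging to \<open>i\<close> only.
  As all generators together are linearly independent and the rows of the codeword sum to zero, the
  codeword vanishes. Independent transcendentals are replaced by the powers \<open>t ^ (2 ^ e)\<close> in
  \<open>GF(2)(t)\<close>, a countable field, which therefore embeds into every infinite type.\<close>

section \<open>Hall's marriage theorem\<close>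

text \<open>Induction on \<open>I\<close>. If some nonempty proper subset \<open>J\<close> is tight,
  \<open>J\<close> is matched first and the rest avoids the neighbours of \<open>J\<close>.
  Otherwise every nonempty proper subset has a surplus, so one index may take any \<open>t\<close>
  and the others avoid \<open>t\<close>.\<close>

theorem hall_marriage:
  assumes "finite I" "\<And>i. i \<in> I \<Longrightarrow> finite (T i)"
    and "\<And>S. S \<subseteq> I \<Longrightarrow> card S \<le> card (\<Union>(T ` S))"
  shows "\<exists>\<sigma>. inj_on \<sigma> I \<and> (\<forall>i\<in>I. \<sigma> i \<in> T i)"
  using assms
proof (induction I arbitrary: T rule: finite_psubset_induct)
  case (psubset I)
  note fin = psubset.prems(1) and cond = psubset.prems(2)
  consider "I = {}" | J where "J \<subset> I" "J \<noteq> {}" "card (\<Union>(T ` J)) \<le> card J"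
    | i where "i \<in> I" "\<And>J. J \<subset> I \<Longrightarrow> J \<noteq> {} \<Longrightarrow> card J < card (\<Union>(T ` J))"
    by (meson all_not_in_conv not_le_imp_less)
  then show ?case
  proof cases
    case 1
    then show ?thesis by simp
  next
    case (2 J)
    have fJ: "finite J" using 2(1) psubset.hyps finite_subset by blast
    have tight: "card (\<Union>(T ` J)) = card J" using 2 cond[of J] by fastforce
    obtain \<sigma> where \<sigma>: "inj_on \<sigma> J" "\<forall>i\<in>J. \<sigma> i \<in> T i"
      using psubset.IH[OF 2(1), of T] fin cond 2(1) by (meson psubsetD psubset_imp_subset subset_trans)
    have "\<exists>\<tau>. inj_on \<tau> (I - J) \<and> (\<forall>i\<in>I - J. \<tau> i \<in> T i - \<Union>(T ` J))"
    proof (rule psubset.IH)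
      show "I - J \<subset> I" using 2 by blast
      show "finite (T i - \<Union>(T ` J))" if "i \<in> I - J" for i using fin that by blast
      fix S assume S: "S \<subseteq> I - J"
      then have fS: "finite S" using psubset.hyps finite_subset by blast
      have "card S + card J = card (S \<union> J)" using S fS fJ by (subst card_Un_disjoint) auto
      also have "\<dots> \<le> card (\<Union>(T ` (S \<union> J)))" by (rule cond) (use S 2 in auto)
      also have "\<Union>(T ` (S \<union> J)) = (\<Union>i\<in>S. T i - \<Union>(T ` J)) \<union> \<Union>(T ` J)" by auto
      also have "card \<dots> \<le> card (\<Union>i\<in>S. T i - \<Union>(T ` J)) + card (\<Union>(T ` J))" by (rule card_Un_le)
      finally show "card S \<le> card (\<Union>i\<in>S. T i - \<Union>(T ` J))" using tight by simp
    qed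
    then obtain \<tau> where \<tau>: "inj_on \<tau> (I - J)" "\<forall>i\<in>I - J. \<tau> i \<in> T i - \<Union>(T ` J)" by blast
    have "inj_on (\<lambda>i. if i \<in> J then \<sigma> i else \<tau> i) I"
    proof (rule inj_onI)
      fix x y assume "x \<in> I" "y \<in> I" "(if x \<in> J then \<sigma> x else \<tau> x) = (if y \<in> J then \<sigma> y else \<tau> y)"
      then show "x = y"
        using \<sigma> \<tau> by (cases "x \<in> J"; cases "y \<in> J") (auto dest: inj_onD, (metis DiffI)+)
    qed
    moreover have "\<forall>i\<in>I. (if i \<in> J then \<sigma> i else \<tau> i) \<in> T i" using \<sigma> \<tau> by auto
    ultimately show ?thesis by (intro exI[of _ "\<lambda>i. if i \<in> J then \<sigma> i else \<tau> i"] conjI)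
  next
    case (3 i)
    have "card {i} \<le> card (\<Union>(T ` {i}))" by (rule cond) (use 3 in auto)
    then have "card (T i) > 0" by simp
    then obtain t where t: "t \<in> T i" by (metis card_gt_0_iff ex_in_conv)
    have "\<exists>\<tau>. inj_on \<tau> (I - {i}) \<and> (\<forall>k\<in>I - {i}. \<tau> k \<in> T k - {t})"
    proof (rule psubset.IH)
      show "I - {i} \<subset> I" using 3 by blast
      show "finite (T k - {t})" if "k \<in> I - {i}" for k using fin that by blast
      fix S assume S: "S \<subseteq> I - {i}"
      show "card S \<le> card (\<Union>k\<in>S. T k - {t})"
      proof (cases "S = {}")
        case False
        then have "card S < card (\<Union>(T ` S))" using 3 S by (intro 3) auto
        moreover have "(\<Union>k\<in>S. T k - {t}) = \<Union>(T ` S) - {t}" by auto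
        ultimately show ?thesis by (auto simp: card_Diff_singleton_if)
      qed simp
    qed
    then obtain \<tau> where \<tau>: "inj_on \<tau> (I - {i})" "\<forall>k\<in>I - {i}. \<tau> k \<in> T k - {t}" by blast
    have "inj_on (\<tau>(i := t)) I"
    proof (rule inj_onI)
      fix x y assume "x \<in> I" "y \<in> I" "(\<tau>(i := t)) x = (\<tau>(i := t)) y"
      then show "x = y" using \<tau> by (auto split: if_splits dest: inj_onD)
    qed
    moreover have "\<forall>k\<in>I. (\<tau>(i := t)) k \<in> T k" using \<tau> t by auto
    ultimately show ?thesis by blast
  qed
qed

section \<open>Generic matrices with prescribed supports\<close>

definition generic_poly :: "('i::countable \<Rightarrow> 'j::countable set) \<Rightarrow> 'i \<Rightarrow> 'j \<Rightarrow> 'a::idom poly" where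
  "generic_poly T l j = (if j \<in> T l then monom 1 (2 ^ to_nat (l, j)) else 0)"

definition generic_matrix :: "('i::countable \<Rightarrow> 'j::countable set) \<Rightarrow> 'i \<Rightarrow> 'j \<Rightarrow> 'a::idom poly fract" where
  "generic_matrix T l j = to_fract (generic_poly T l j)"

text \<open>Sums of distinct powers of 2 are distinct, so the monomials of the Leibniz expansion cannot cancel.\<close>

lemma det_generic_poly_neq_0:
  fixes T :: "'i::countable \<Rightarrow> 'j::countable set"
  assumes h: "inj_on h {..<s}" and g: "inj_on g {..<s}" and T: "\<And>a. a < s \<Longrightarrow> g a \<in> T (h a)"
  shows "det (mat s s (\<lambda>(a, c). generic_poly T (h a) (g c) :: 'a::idom poly)) \<noteq> 0"
proof -
  \<comment> \<open>The codes of the cells selected by the permutation \<open>p\<close>. As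
    \<open>h\<close>, \<open>g\<close> and \<open>to_nat\<close> are injective, this set singles out
    the identity.\<close>
  define cells where "cells p = (\<lambda>a. to_nat (h a, g (p a))) ` {0..<s}" for p
  have cells: "cells p = cells id \<longleftrightarrow> p = id" if p: "p permutes {0..<s}" for p
  proof
    assume eq: "cells p = cells id"
    show "p = id"
    proof
      fix a
      show "p a = id a"
      proof (cases "a < s")
        case True
        then have "to_nat (h a, g (p a)) \<in> cells p" by (auto simp: cells_def)
        then have "to_nat (h a, g (p a)) \<in> cells id" by (simp only: eq)
        then obtain c where c: "c < s" "h a = h c" "g (p a) = g c" by (auto simp: cells_def)
        have "p a < s" using permutes_in_image[OF p, of a] True by simp
        then have "p a = c" "a = c" using c True inj_onD[OF g c(3)] inj_onD[OF h c(2)] by auto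
        then show ?thesis by simp
      qed (use permutes_not_in[OF p, of a] in simp)
    qed
  qed simp
  \<comment> \<open>\<open>set_encode\<close> sums the powers of 2 indexed by a set, so the exponent
    records the selected cells in binary.\<close>
  have prod: "(\<Prod>a = 0..<s. generic_poly T (h a) (g (p a)) :: 'a poly) =
      (if \<forall>a<s. g (p a) \<in> T (h a) then monom 1 (set_encode (cells p)) else 0)"
    if p: "p permutes {0..<s}" for p
  proof (cases "\<forall>a<s. g (p a) \<in> T (h a)")
    case True
    have "inj_on (\<lambda>a. to_nat (h a, g (p a))) {0..<s}"
      using h by (auto simp: inj_on_def)
    then have "set_encode (cells p) = (\<Sum>a = 0..<s. 2 ^ to_nat (h a, g (p a)))"
      by (simp add: set_encode_def cells_def sum.reindex)
    moreover have "(\<Prod>a = 0..<s. generic_poly T (h a) (g (p a)) :: 'a poly) =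
        (\<Prod>a = 0..<s. monom 1 (2 ^ to_nat (h a, g (p a))))"
      by (rule prod.cong) (use True in \<open>auto simp: generic_poly_def\<close>)
    moreover have "(\<Prod>a\<in>A. monom (1::'a) (f a)) = monom 1 (sum f A)" if "finite A" for A :: "nat set" and f
      using that by (induction A) (auto simp: mult_monom)
    ultimately show ?thesis using True by simp
  next
    case False
    then show ?thesis by (auto simp: generic_poly_def intro!: prod_zero)
  qed
  \<comment> \<open>Only the identity contributes to the coefficient at its own exponent, which is
    therefore 1.\<close>
  have "coeff (det (mat s s (\<lambda>(a, c). generic_poly T (h a) (g c) :: 'a poly))) (set_encode (cells id)) =
      (\<Sum>p | p permutes {0..<s}.
        coeff (signof p * (\<Prod>a = 0..<s. generic_poly T (h a) (g (p a)))) (set_encode (cells id)))"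
    by (subst det_def'[of _ s]) (auto simp: coeff_sum intro!: sum.cong prod.cong
      arg_cong2[where f = coeff] arg_cong2[where f = "(*)"] dest: permutes_in_image)
  also have "\<dots> = (\<Sum>p | p permutes {0..<s}. if p = id then 1 else 0)"
  proof (rule sum.cong)
    fix p assume "p \<in> {p. p permutes {0..<s}}"
    then have p: "p permutes {0..<s}" by simp
    have "finite (cells q)" for q by (simp add: cells_def)
    then have "set_encode (cells p) = set_encode (cells id) \<longleftrightarrow> p = id"
      using cells[OF p] by (metis set_encode_eq)
    moreover have "signof p * q = (if evenperm p then q else - q)" for q :: "'a poly"
      by (simp add: sign_def)
    ultimately show "coeff (signof p * (\<Prod>a = 0..<s. generic_poly T (h a) (g (p a)))) (set_encode (cells id)) =
        (if p = id then 1 else (0::'a))"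
      using T by (auto simp: prod[OF p] evenperm_id)
  qed simp
  also have "\<dots> = 1" by (simp add: sum.delta finite_permutations permutes_id)
  finally show ?thesis by auto
qed

text \<open>Column \<open>\<sigma> u\<close> is named by the row \<open>u\<close> matched to it, so
  \<open>B\<close> is indexed by \<open>S\<close> on both sides. The enumeration \<open>h\<close> of
  \<open>S\<close> translates to matrices with numbered rows and back.\<close>

lemma generic_matrix_invertible:
  fixes T :: "'i::countable \<Rightarrow> 'j::countable set"
  assumes fin: "finite S" and inj: "inj_on \<sigma> S" and T: "\<And>l. l \<in> S \<Longrightarrow> \<sigma> l \<in> T l"
  obtains B :: "'i \<Rightarrow> 'i \<Rightarrow> 'a::idom poly fract" where
    "\<And>l l'. l \<in> S \<Longrightarrow> l' \<in> S \<Longrightarrow> (\<Sum>u\<in>S. generic_matrix T l (\<sigma> u) * B u l') = of_bool (l = l')"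
    "\<And>l l'. l \<in> S \<Longrightarrow> l' \<in> S \<Longrightarrow> (\<Sum>u\<in>S. B l u * generic_matrix T u (\<sigma> l')) = of_bool (l = l')"
proof -
  define s where "s = card S"
  obtain h where h: "bij_betw h {..<s} S"
    using ex_bij_betw_nat_finite[OF fin] by (auto simp: s_def atLeast0LessThan)
  define r where "r = the_inv_into {..<s} h"
  have r: "r l < s" "h (r l) = l" if "l \<in> S" for l
    using that h f_the_inv_into_f_bij_betw[OF h] the_inv_into_into[of h "{..<s}" l "{..<s}"]
    by (auto simp: r_def bij_betw_def)
  have r_inj: "r l = r l' \<longleftrightarrow> l = l'" if "l \<in> S" "l' \<in> S" for l l'
    using r that by metis
  define P where "P = mat s s (\<lambda>(a, c). generic_poly T (h a) (\<sigma> (h c)) :: 'a poly)"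
  define N where "N = mat s s (\<lambda>(a, c). generic_matrix T (h a) (\<sigma> (h c)) :: 'a poly fract)"
  have "det P \<noteq> 0"
    unfolding P_def
  proof (rule det_generic_poly_neq_0[where g = "\<sigma> \<circ> h", unfolded o_def])
    show "inj_on h {..<s}" using h by (simp add: bij_betw_def)
    then show "inj_on (\<lambda>x. \<sigma> (h x)) {..<s}"
      using comp_inj_on[of h "{..<s}" \<sigma>] inj h by (simp add: bij_betw_def o_def)
    show "\<sigma> (h a) \<in> T (h a)" if "a < s" for a using T h that by (auto simp: bij_betw_def)
  qed
  \<comment> \<open>The homomorphism carries the nonzero determinant from polynomials to their
    fraction field, where it gives an inverse.\<close>
  interpret to_fract: comm_ring_hom "to_fract :: 'a poly \<Rightarrow> _"
    by unfold_locales auto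
  have "N = map_mat to_fract P" by (auto simp: N_def P_def generic_matrix_def)
  then have "det N \<noteq> 0" using \<open>det P \<noteq> 0\<close> by simp
  moreover have N: "N \<in> carrier_mat s s" by (simp add: N_def)
  ultimately have "N \<in> Units (ring_mat TYPE('a poly fract) s ())" by (rule det_non_zero_imp_unit[rotated])
  then obtain Q where Q: "Q \<in> carrier_mat s s" "Q * N = 1\<^sub>m s" "N * Q = 1\<^sub>m s"
    by (auto simp: Units_def ring_mat_def)
  have reindex: "(\<Sum>u\<in>S. f u) = (\<Sum>c = 0..<s. f (h c))" for f :: "'i \<Rightarrow> 'a poly fract"
    using sum.reindex_bij_betw[OF h, of f] by (simp add: atLeast0LessThan)
  have rh: "r (h c) = c" if "c < s" for c
    using h that by (simp add: r_def bij_betw_def the_inv_into_f_f)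
  show thesis
  proof (rule that[of "\<lambda>l l'. Q $$ (r l, r l')"])
    fix l l' assume l: "l \<in> S" "l' \<in> S"
    have "(N * Q) $$ (r l, r l') = (\<Sum>c = 0..<s. generic_matrix T l (\<sigma> (h c)) * Q $$ (c, r l'))"
      using r l N Q(1) by (auto simp: scalar_prod_def N_def intro!: sum.cong)
    then show "(\<Sum>u\<in>S. generic_matrix T l (\<sigma> u) * Q $$ (r u, r l')) = of_bool (l = l')"
      unfolding reindex using r l Q(3) r_inj rh by (simp add: of_bool_def)
    have "(Q * N) $$ (r l, r l') = (\<Sum>c = 0..<s. Q $$ (r l, c) * generic_matrix T (h c) (\<sigma> l'))"
      using r l N Q(1) by (auto simp: scalar_prod_def N_def intro!: sum.cong)
    then show "(\<Sum>u\<in>S. Q $$ (r l, r u) * generic_matrix T u (\<sigma> l')) = of_bool (l = l')"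
      unfolding reindex using r l Q(2) r_inj rh by (simp add: of_bool_def)
  qed
qed

section \<open>Countability of the field of rational functions\<close>

lemma countable_poly_fract:
  assumes "countable (UNIV :: 'a::idom set)"
  shows "countable (UNIV :: 'a poly fract set)"
proof -
  have "countable (lists (UNIV :: 'a set))" using assms by (rule countable_lists)
  then have "countable (range (coeffs :: 'a poly \<Rightarrow> _))" by (rule countable_subset[rotated]) auto
  then have "countable (UNIV :: 'a poly set)"
    by (rule countable_image_inj_on) (simp add: inj_on_def coeffs_eq_iff)
  then have "countable (range (\<lambda>(p, q). Fract p q) :: 'a poly fract set)"
    by (intro countable_image) (metis UNIV_Times_UNIV countable_SIGMA)
  moreover have "range (\<lambda>(p, q). Fract p q) = (UNIV :: 'a poly fract set)"
  proof -
    have "x \<in> range (\<lambda>(p, q). Fract p q)" for x :: "'a poly fract" by (cases x) auto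
    then show ?thesis by blast
  qed
  ultimately show ?thesis by simp
qed

section \<open>Parity checks and independence of the generators\<close>

text \<open>The witness is the systematic parity check matrix of the row space of \<open>M\<close>.\<close>

lemma parity_check:
  fixes M :: "'i \<Rightarrow> nat \<Rightarrow> 'k::comm_ring_1"
  assumes fin: "finite R" and bij: "bij_betw \<sigma> R {1..q}" and "q + b = n"
    and MB: "\<And>l l'. l \<in> R \<Longrightarrow> l' \<in> R \<Longrightarrow> (\<Sum>u\<in>R. M l (\<sigma> u) * B u l') = of_bool (l = l')"
    and BM: "\<And>l l'. l \<in> R \<Longrightarrow> l' \<in> R \<Longrightarrow> (\<Sum>u\<in>R. B l u * M u (\<sigma> l')) = of_bool (l = l')"
  shows "\<exists>\<beta> :: nat \<Rightarrow> nat \<Rightarrow> 'k. \<forall>y. (\<forall>k\<in>{1..b}. (\<Sum>j\<in>{1..n}. \<beta> k j * y j) = 0) \<longrightarrow>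
    (\<exists>c. \<forall>j\<in>{1..n}. y j = (\<Sum>l\<in>R. c l * M l j))"
proof -
  define r where "r = the_inv_into R \<sigma>"
  have r: "r j \<in> R" "\<sigma> (r j) = j" if "j \<in> {1..q}" for j
    using that bij f_the_inv_into_f_bij_betw[OF bij] the_inv_into_into[of \<sigma> R j R]
    by (auto simp: r_def bij_betw_def)
  have \<sigma>: "\<sigma> u \<in> {1..q}" "r (\<sigma> u) = u" if "u \<in> R" for u
    using that bij by (auto simp: r_def bij_betw_def the_inv_into_f_f)
  \<comment> \<open>The product of \<open>B\<close> and \<open>M\<close>: reduced generators, with
    the identity matrix in the columns matched by \<open>\<sigma>\<close>.\<close>
  define p where "p u j = (\<Sum>l\<in>R. B u l * M l j)" for u j
  have Mp: "(\<Sum>u\<in>R. M l (\<sigma> u) * p u j) = M l j" if "l \<in> R" for l j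
  proof -
    have "(\<Sum>u\<in>R. M l (\<sigma> u) * p u j) = (\<Sum>u\<in>R. \<Sum>l'\<in>R. M l (\<sigma> u) * B u l' * M l' j)"
      by (simp add: p_def sum_distrib_left mult.assoc)
    also have "\<dots> = (\<Sum>l'\<in>R. (\<Sum>u\<in>R. M l (\<sigma> u) * B u l') * M l' j)"
      by (subst sum.swap) (simp add: sum_distrib_right)
    also have "\<dots> = (\<Sum>l'\<in>R. if l = l' then M l' j else 0)"
      by (rule sum.cong) (auto simp: MB that)
    finally show ?thesis using fin that by simp
  qed
  \<comment> \<open>With the reduced generators written as \<open>(I | P)\<close>, this is
    \<open>(-P^T | I)\<close>; \<open>r j\<close> is the generator matched to column
    \<open>j\<close>.\<close>
  define \<beta> where "\<beta> k j = (if j \<le> q then - p (r j) (q + k) else of_bool (j = q + k))" for k j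
  show ?thesis
  proof (intro exI[of _ \<beta>] allI impI)
    fix y assume y: "\<forall>k\<in>{1..b}. (\<Sum>j\<in>{1..n}. \<beta> k j * y j) = 0"
    \<comment> \<open>The combination that agrees with \<open>y\<close> on the columns
      \<open>{1..q}\<close>; the checks then force agreement on the remaining ones.\<close>
    define c where "c l = (\<Sum>u\<in>R. y (\<sigma> u) * B u l)" for l
    have c: "(\<Sum>l\<in>R. c l * M l (\<sigma> u)) = y (\<sigma> u)" if "u \<in> R" for u
    proof -
      have "(\<Sum>l\<in>R. c l * M l (\<sigma> u)) = (\<Sum>l\<in>R. \<Sum>u'\<in>R. y (\<sigma> u') * (B u' l * M l (\<sigma> u)))"
        by (simp add: c_def sum_distrib_right mult.assoc)
      also have "\<dots> = (\<Sum>u'\<in>R. y (\<sigma> u') * (\<Sum>l\<in>R. B u' l * M l (\<sigma> u)))"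
        by (subst sum.swap) (simp add: sum_distrib_left)
      also have "\<dots> = (\<Sum>u'\<in>R. if u' = u then y (\<sigma> u') else 0)"
        by (rule sum.cong) (auto simp: BM that)
      finally show ?thesis using fin that by simp
    qed
    have "y j = (\<Sum>l\<in>R. c l * M l j)" if j: "j \<in> {1..n}" for j
    proof (cases "j \<le> q")
      case True
      then show ?thesis using c[of "r j"] r[of j] j by simp
    next
      case False
      define k where "k = j - q"
      have k: "k \<in> {1..b}" "j = q + k" using False j \<open>q + b = n\<close> by (auto simp: k_def)
      have "0 = (\<Sum>i\<in>{1..n}. \<beta> k i * y i)" using y k by simp
      also have "{1..n} = {1..q} \<union> {q<..n}" using \<open>q + b = n\<close> by auto
      also have "(\<Sum>i\<in>\<dots>. \<beta> k i * y i) = (\<Sum>i\<in>{1..q}. \<beta> k i * y i) + (\<Sum>i\<in>{q<..n}. \<beta> k i * y i)"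
        by (rule sum.union_disjoint) auto
      also have "(\<Sum>i\<in>{q<..n}. \<beta> k i * y i) = (\<Sum>i\<in>{q<..n}. if i = j then y i else 0)"
        by (rule sum.cong) (auto simp: \<beta>_def k)
      also have "\<dots> = y j" using False j by simp
      also have "(\<Sum>i\<in>{1..q}. \<beta> k i * y i) = (\<Sum>u\<in>R. \<beta> k (\<sigma> u) * y (\<sigma> u))"
        by (rule sum.reindex_bij_betw[OF bij, symmetric])
      also have "\<dots> = (\<Sum>u\<in>R. - (y (\<sigma> u) * p u j))"
        by (rule sum.cong) (use \<sigma> in \<open>auto simp: \<beta>_def k\<close>)
      finally have "y j = (\<Sum>u\<in>R. y (\<sigma> u) * p u j)"
        by (simp add: sum_negf)
      also have "\<dots> = (\<Sum>u\<in>R. \<Sum>l\<in>R. c l * (M l (\<sigma> u) * p u j))"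
        by (rule sum.cong) (simp_all flip: c add: sum_distrib_right mult.assoc)
      also have "\<dots> = (\<Sum>l\<in>R. c l * (\<Sum>u\<in>R. M l (\<sigma> u) * p u j))"
        by (subst sum.swap) (simp add: sum_distrib_left)
      finally show ?thesis by (simp add: Mp)
    qed
    then show "\<exists>c. \<forall>j\<in>{1..n}. y j = (\<Sum>l\<in>R. c l * M l j)" by blast
  qed
qed

text \<open>Multiplication by a right inverse of the submatrix on the columns
  \<open>\<sigma> u\<close> isolates each coefficient. This serves twice: for the independence of
  all generators, and for excluding the generators of other rows from row \<open>i\<close>.\<close>

lemma generic_matrix_left_kernel:
  fixes T :: "'i::countable \<Rightarrow> 'j::countable set" and c :: "'i \<Rightarrow> 'a::idom poly fract"
  assumes fin: "finite S" and inj: "inj_on \<sigma> S" and T: "\<And>l. l \<in> S \<Longrightarrow> \<sigma> l \<in> T l"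
    and c: "\<And>u. u \<in> S \<Longrightarrow> (\<Sum>l\<in>S. c l * generic_matrix T l (\<sigma> u)) = 0" and l: "l \<in> S"
  shows "c l = 0"
proof -
  obtain B :: "'i \<Rightarrow> 'i \<Rightarrow> 'a poly fract" where B: "\<And>l l'. l \<in> S \<Longrightarrow> l' \<in> S \<Longrightarrow>
      (\<Sum>u\<in>S. generic_matrix T l (\<sigma> u) * B u l') = of_bool (l = l')"
    using generic_matrix_invertible[OF fin inj T] by metis
  have "0 = (\<Sum>u\<in>S. (\<Sum>l'\<in>S. c l' * generic_matrix T l' (\<sigma> u)) * B u l)"
    using c by simp
  also have "\<dots> = (\<Sum>u\<in>S. \<Sum>l'\<in>S. c l' * (generic_matrix T l' (\<sigma> u) * B u l))"
    by (simp add: sum_distrib_right mult.assoc)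
  also have "\<dots> = (\<Sum>l'\<in>S. c l' * (\<Sum>u\<in>S. generic_matrix T l' (\<sigma> u) * B u l))"
    by (subst sum.swap) (simp add: sum_distrib_left)
  also have "\<dots> = (\<Sum>l'\<in>S. if l' = l then c l' else 0)"
    by (rule sum.cong) (auto simp: B l)
  finally show ?thesis using fin l by simp
qed

section \<open>Generator rows and Hall's condition\<close>

text \<open>Row \<open>i\<close> of a codeword supported in \<open>E\<close> ranges over a space of dimension
  \<open>card (E `` {i}) - b\<close>, for which the generator matrix has as many rows \<open>(i, r)\<close> with support in
  \<open>E `` {i}\<close>. The rows \<open>(0, r)\<close> are filled up arbitrarily.\<close>

definition gen_rows :: "nat \<Rightarrow> nat \<Rightarrow> nat \<Rightarrow> (nat \<times> nat) set \<Rightarrow> (nat \<times> nat) set" where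
  "gen_rows m n b E = (SIGMA i:{1..m}. {..<card (E `` {i}) - b}) \<union>
     {0} \<times> {..<n - b - (\<Sum>i\<in>{1..m}. card (E `` {i}) - b)}"

text \<open>Rows of the array are numbered from 1, so the label 0 is free to mark the generators
  with unrestricted support.\<close>

definition gen_support :: "nat \<Rightarrow> (nat \<times> nat) set \<Rightarrow> nat \<times> nat \<Rightarrow> nat set" where
  "gen_support n E l = (if fst l = 0 then {1..n} else E `` {fst l})"

lemma finite_gen_rows: "finite (gen_rows m n b E)"
  by (simp add: gen_rows_def)

lemma gen_support_subset:
  "E \<subseteq> {1..m} \<times> {1..n} \<Longrightarrow> gen_support n E l \<subseteq> {1..n}"
  by (auto simp: gen_support_def)

text \<open>Regularity is applied with \<open>V\<close> the set of all columns met by the rows in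
  \<open>U\<close>, so that all erasures of these rows are counted. The lower bound on the row sizes
  gives \<open>V\<close> at least \<open>b\<close> columns and makes every truncated subtraction
  exact.\<close>

lemma regular_sum_le:
  assumes reg: "regular m n b E" and E: "E \<subseteq> {1..m} \<times> {1..n}"
    and U: "U \<subseteq> {1..m}" "U \<noteq> {}" "\<And>i. i \<in> U \<Longrightarrow> b \<le> card (E `` {i})"
  shows "(\<Sum>i\<in>U. card (E `` {i}) - b) + b \<le> card (E `` U)"
proof -
  have fE: "finite E" using E finite_subset by blast
  have fU: "finite U" using U finite_subset by blast
  have fi: "finite (E `` A)" for A using E by (rule_tac finite_subset[of _ "{1..n}"]) auto
  obtain i where i: "i \<in> U" using U by blast
  have "b \<le> card (E `` {i})" using U i by blast
  also have "\<dots> \<le> card (E `` U)" using i by (intro card_mono fi) auto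
  finally have b: "b \<le> card (E `` U)" .
  have "card U \<ge> 1" using U fU by (simp add: Suc_leI card_gt_0_iff)
  have "E \<inter> U \<times> (E `` U) = (SIGMA i:U. E `` {i})" by auto
  then have "card (E \<inter> U \<times> (E `` U)) = (\<Sum>i\<in>U. card (E `` {i}))"
    using fU fi by simp
  moreover have "card (E \<inter> U \<times> (E `` U)) \<le> card (E `` U) + card U * b - b"
    using U E b \<open>card U \<ge> 1\<close> by (intro reg[unfolded regular_def, rule_format]) auto
  moreover have "(\<Sum>i\<in>U. card (E `` {i})) = (\<Sum>i\<in>U. card (E `` {i}) - b) + card U * b"
  proof -
    have "(\<Sum>i\<in>U. card (E `` {i})) = (\<Sum>i\<in>U. (card (E `` {i}) - b) + b)"
      by (rule sum.cong) (use U in auto)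
    then show ?thesis by (simp add: sum.distrib)
  qed
  ultimately show ?thesis using \<open>card U \<ge> 1\<close> b by simp
qed

context
  fixes m n b :: nat and E :: "(nat \<times> nat) set"
  assumes reg: "regular m n b E" and E: "E \<subseteq> {1..m} \<times> {1..n}" and b: "b \<le> n"
begin

text \<open>Ensures that the number of unrestricted generators does not truncate, so that there are
  exactly \<open>n - b\<close> generators in total.\<close>

lemma sum_excess_le: "(\<Sum>i\<in>{1..m}. card (E `` {i}) - b) \<le> n - b"
proof -
  \<comment> \<open>Rows with at most \<open>b\<close> erasures contribute 0 by truncation;
    \<open>regular_sum_le\<close> applies to the others.\<close>
  define U where "U = {i \<in> {1..m}. b < card (E `` {i})}"
  have "(\<Sum>i\<in>{1..m}. card (E `` {i}) - b) = (\<Sum>i\<in>U. card (E `` {i}) - b)"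
    by (rule sum.mono_neutral_right) (auto simp: U_def)
  also have "\<dots> \<le> n - b"
  proof (cases "U = {}")
    case False
    have "(\<Sum>i\<in>U. card (E `` {i}) - b) + b \<le> card (E `` U)"
      by (rule regular_sum_le[OF reg E]) (use False in \<open>auto simp: U_def\<close>)
    also have "\<dots> \<le> card {1..n}" using E by (intro card_mono) auto
    finally show ?thesis by simp
  qed simp
  finally show ?thesis .
qed

lemma card_gen_rows: "card (gen_rows m n b E) = n - b"
proof -
  have "card (gen_rows m n b E) = card (SIGMA i:{1..m}. {..<card (E `` {i}) - b}) +
      card ({0::nat} \<times> {..<n - b - (\<Sum>i\<in>{1..m}. card (E `` {i}) - b)})"
    unfolding gen_rows_def by (rule card_Un_disjoint) auto
  then show ?thesis using sum_excess_le by simp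
qed

lemma gen_support_expands:
  assumes S: "S \<subseteq> gen_rows m n b E" "S \<noteq> {}"
  shows "card S + b \<le> card (\<Union>(gen_support n E ` S))"
proof (cases "0 \<in> fst ` S")
  case True
  then have "{1..n} \<subseteq> \<Union>(gen_support n E ` S)" by (force simp: gen_support_def)
  then have eq: "\<Union>(gen_support n E ` S) = {1..n}" using gen_support_subset[OF E] by blast
  have "card S \<le> card (gen_rows m n b E)" using S finite_gen_rows by (intro card_mono)
  then show ?thesis using b unfolding eq card_gen_rows by simp
next
  case False
  define U where "U = fst ` S"
  have S': "S \<subseteq> (SIGMA i:U. {..<card (E `` {i}) - b})" and U: "U \<subseteq> {1..m}" "U \<noteq> {}"
    using S False by (force simp: U_def gen_rows_def)+
  have U': "b \<le> card (E `` {i})" if "i \<in> U" for i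
    using S False that by (force simp: U_def gen_rows_def)
  have "finite U" using U finite_subset by blast
  then have "card S \<le> (\<Sum>i\<in>U. card (E `` {i}) - b)" using card_mono[OF _ S'] by simp
  then have "card S + b \<le> card (E `` U)"
    using regular_sum_le[OF reg E U U'] by simp
  also have "E `` U = \<Union>(gen_support n E ` S)"
    using False by (force simp: U_def gen_support_def)
  finally show ?thesis .
qed

text \<open>Hall's theorem after deleting the columns \<open>A\<close>, which the surplus has to pay
  for. It is applied to the last \<open>b\<close> columns and to the columns erased in one
  row.\<close>

lemma gen_rows_match:
  assumes S: "S \<subseteq> gen_rows m n b E"
    and A: "\<And>S'. S' \<subseteq> S \<Longrightarrow> S' \<noteq> {} \<Longrightarrow> card S' + card A \<le> card (\<Union>(gen_support n E ` S') \<union> A)"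
    and "finite A"
  shows "\<exists>\<sigma>. inj_on \<sigma> S \<and> (\<forall>l\<in>S. \<sigma> l \<in> gen_support n E l - A)"
proof (rule hall_marriage)
  show "finite S" using S finite_gen_rows finite_subset by blast
  show "finite (gen_support n E l - A)" for l
    using gen_support_subset[OF E] finite_subset by blast
  fix S' assume S': "S' \<subseteq> S"
  show "card S' \<le> card (\<Union>l\<in>S'. gen_support n E l - A)"
  proof (cases "S' = {}")
    case False
    have "card S' + card A \<le> card (\<Union>(gen_support n E ` S') \<union> A)" using A S' False by blast
    also have "\<Union>(gen_support n E ` S') \<union> A = (\<Union>l\<in>S'. gen_support n E l - A) \<union> A" by auto
    also have "card \<dots> \<le> card (\<Union>l\<in>S'. gen_support n E l - A) + card A" by (rule card_Un_le)
    finally show ?thesis by simp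
  qed simp
qed

end

section \<open>The generic code corrects every regular pattern\<close>

lemma regular_imp_generic_code_corrects:
  assumes reg: "regular m n b E" and E: "E \<subseteq> {1..m} \<times> {1..n}" and b: "b \<le> n"
  shows "\<exists>\<beta> :: nat \<Rightarrow> nat \<Rightarrow> 'a::idom poly fract. \<forall>x.
    (\<forall>j\<in>{1..n}. (\<Sum>i\<in>{1..m}. x (i, j)) = 0) \<longrightarrow>
    (\<forall>i\<in>{1..m}. \<forall>k\<in>{1..b}. (\<Sum>j\<in>{1..n}. \<beta> k j * x (i, j)) = 0) \<longrightarrow>
    (\<forall>p\<in>{1..m} \<times> {1..n} - E. x p = 0) \<longrightarrow> (\<forall>p\<in>{1..m} \<times> {1..n}. x p = 0)"
proof -
  define R where "R = gen_rows m n b E"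
  define M :: "nat \<times> nat \<Rightarrow> nat \<Rightarrow> 'a poly fract" where "M = generic_matrix (gen_support n E)"
  note hyps = reg E b
  have fR: "finite R" by (simp add: R_def finite_gen_rows)
  have sub: "gen_support n E l \<subseteq> {1..n}" for l using gen_support_subset[OF E] .
  have fUN: "finite (\<Union>(gen_support n E ` S))" for S
    by (rule finite_subset[of _ "{1..n}"]) (use sub in auto)
  have expands: "card S + b \<le> card (\<Union>(gen_support n E ` S))" if "S \<subseteq> R" "S \<noteq> {}" for S
    using gen_support_expands[OF hyps] that by (simp add: R_def)
  \<comment> \<open>Avoiding the last \<open>b\<close> columns forces the matching onto exactly the
    first \<open>n - b\<close>, as \<open>parity_check\<close> requires.\<close>
  have "\<exists>\<sigma>. inj_on \<sigma> R \<and> (\<forall>l\<in>R. \<sigma> l \<in> gen_support n E l - {n-b<..n})"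
    unfolding R_def
  proof (rule gen_rows_match[OF hyps order_refl])
    fix S assume S: "S \<subseteq> gen_rows m n b E" "S \<noteq> {}"
    have "card S + b \<le> card (\<Union>(gen_support n E ` S))" using expands S by (simp add: R_def)
    also have "\<dots> \<le> card (\<Union>(gen_support n E ` S) \<union> {n-b<..n})"
      by (intro card_mono) (use fUN in auto)
    finally show "card S + card {n-b<..n} \<le> card (\<Union>(gen_support n E ` S) \<union> {n-b<..n})"
      using b by simp
  qed simp
  then obtain \<sigma> where \<sigma>: "inj_on \<sigma> R" "\<And>l. l \<in> R \<Longrightarrow> \<sigma> l \<in> gen_support n E l - {n-b<..n}" by blast
  have "\<sigma> ` R = {1..n-b}"
  proof (rule card_subset_eq)
    show "\<sigma> ` R \<subseteq> {1..n-b}"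
    proof
      fix j assume "j \<in> \<sigma> ` R"
      then obtain l where "l \<in> R" "j = \<sigma> l" by blast
      then show "j \<in> {1..n-b}" using \<sigma>(2)[of l] sub[of l] by auto
    qed
    show "card (\<sigma> ` R) = card {1..n-b}"
      using \<sigma>(1) card_gen_rows[OF hyps] by (simp add: card_image R_def)
  qed simp
  then have bij: "bij_betw \<sigma> R {1..n-b}" using \<sigma> by (simp add: bij_betw_def)
  obtain B :: "nat \<times> nat \<Rightarrow> nat \<times> nat \<Rightarrow> 'a poly fract" where B:
    "\<And>l l'. l \<in> R \<Longrightarrow> l' \<in> R \<Longrightarrow> (\<Sum>u\<in>R. M l (\<sigma> u) * B u l') = of_bool (l = l')"
    "\<And>l l'. l \<in> R \<Longrightarrow> l' \<in> R \<Longrightarrow> (\<Sum>u\<in>R. B l u * M u (\<sigma> l')) = of_bool (l = l')"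
    using generic_matrix_invertible[OF fR \<sigma>(1), of "gen_support n E"] \<sigma>(2) unfolding M_def by blast
  have nb: "n - b + b = n" using b by simp
  obtain \<beta> :: "nat \<Rightarrow> nat \<Rightarrow> 'a poly fract" where
    \<beta>: "\<forall>y. (\<forall>k\<in>{1..b}. (\<Sum>j\<in>{1..n}. \<beta> k j * y j) = 0) \<longrightarrow>
      (\<exists>c. \<forall>j\<in>{1..n}. y j = (\<Sum>l\<in>R. c l * M l j))"
    using parity_check[OF fR bij nb B] by blast
  show ?thesis
  proof (intro exI[of _ \<beta>] allI impI)
    fix x :: "nat \<times> nat \<Rightarrow> 'a poly fract"
    assume col: "\<forall>j\<in>{1..n}. (\<Sum>i\<in>{1..m}. x (i, j)) = 0"
      and row: "\<forall>i\<in>{1..m}. \<forall>k\<in>{1..b}. (\<Sum>j\<in>{1..n}. \<beta> k j * x (i, j)) = 0"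
      and supp: "\<forall>p\<in>{1..m} \<times> {1..n} - E. x p = 0"
    have "\<exists>c. \<forall>j\<in>{1..n}. x (i, j) = (\<Sum>l\<in>R. c l * M l j)" if "i \<in> {1..m}" for i
      using \<beta>[rule_format, of "\<lambda>j. x (i, j)"] row that by simp
    then obtain c where c: "\<And>i j. i \<in> {1..m} \<Longrightarrow> j \<in> {1..n} \<Longrightarrow> x (i, j) = (\<Sum>l\<in>R. c i l * M l j)"
      by metis
    \<comment> \<open>Only the generators belonging to row \<open>i\<close> occur in row
      \<open>i\<close>. This excludes the unrestricted ones too, as their label is 0.\<close>
    have off: "c i l = 0" if i: "i \<in> {1..m}" and l: "l \<in> R" "fst l \<noteq> i" for i l
    proof -
      define G where "G = {l \<in> R. fst l = i}"
      define A where "A = E `` {i}"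
      have fA: "finite A" using E by (auto simp: A_def intro!: finite_subset[of _ "{1..n}"])
      have "G = {i} \<times> {..<card A - b}" using i by (auto simp: G_def R_def gen_rows_def A_def)
      then have cG: "card G = card A - b" by simp
      have GA: "gen_support n E u = A" if "u \<in> G" for u
        using that i by (auto simp: G_def gen_support_def A_def)
      have fG: "finite G" using fR by (simp add: G_def)
      have "\<exists>\<tau>. inj_on \<tau> (R - G) \<and> (\<forall>l\<in>R - G. \<tau> l \<in> gen_support n E l - A)"
      proof (rule gen_rows_match[OF hyps])
        show "R - G \<subseteq> gen_rows m n b E" by (auto simp: R_def)
        fix S assume S: "S \<subseteq> R - G" "S \<noteq> {}"
        have "finite S" using S fR finite_subset by blast
        then have "card (S \<union> G) = card S + card G"
          using S fG by (intro card_Un_disjoint) auto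
        \<comment> \<open>\<open>card A \<le> card G + b\<close> holds even if the subtraction in
          \<open>cG\<close> truncates, so the surplus of \<open>S \<union> G\<close> pays for
          deleting \<open>A\<close>.\<close>
        then have "card S + card A \<le> card (S \<union> G) + b" using cG by simp
        also have "\<dots> \<le> card (\<Union>(gen_support n E ` (S \<union> G)))"
          by (rule expands) (use S in \<open>auto simp: G_def\<close>)
        also have "\<dots> \<le> card (\<Union>(gen_support n E ` S) \<union> A)"
          by (intro card_mono) (use fUN fA GA in auto)
        finally show "card S + card A \<le> card (\<Union>(gen_support n E ` S) \<union> A)" .
      qed (rule fA)
      then obtain \<tau> where \<tau>: "inj_on \<tau> (R - G)" "\<And>l. l \<in> R - G \<Longrightarrow> \<tau> l \<in> gen_support n E l - A" by blast
      show ?thesis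
      proof (rule generic_matrix_left_kernel[OF _ \<tau>(1), of "gen_support n E"])
        fix u assume u: "u \<in> R - G"
        then have \<tau>u: "\<tau> u \<in> {1..n}" "\<tau> u \<notin> A" using \<tau>(2) sub by blast+
        \<comment> \<open>Column \<open>\<tau> u\<close> lies outside \<open>A\<close>: there the
          generators in \<open>G\<close> vanish, and so does row \<open>i\<close> of the
          codeword.\<close>
        have "(\<Sum>l\<in>R - G. c i l * M l (\<tau> u)) = (\<Sum>l\<in>R. c i l * M l (\<tau> u))"
          by (rule sum.mono_neutral_left)
            (use fR GA \<tau>u in \<open>auto simp: M_def generic_matrix_def generic_poly_def\<close>)
        also have "\<dots> = x (i, \<tau> u)" using c i \<tau>u by simp
        also have "\<dots> = 0" using supp i \<tau>u by (auto simp: A_def)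
        finally show "(\<Sum>l\<in>R - G. c i l * generic_matrix (gen_support n E) l (\<tau> u)) = 0"
          by (simp add: M_def)
      qed (use fR \<tau>(2) l in \<open>auto simp: G_def\<close>)
    qed
    \<comment> \<open>The rows of the codeword sum to zero, and this sum is a combination of
      independent generators.\<close>
    have total: "(\<Sum>i\<in>{1..m}. c i l) = 0" if l: "l \<in> R" for l
    proof (rule generic_matrix_left_kernel[OF fR \<sigma>(1), of "gen_support n E" "\<lambda>l. \<Sum>i\<in>{1..m}. c i l"])
      fix u assume "u \<in> R"
      then have u: "\<sigma> u \<in> {1..n}" using \<sigma>(2) sub by blast
      have "(\<Sum>l\<in>R. (\<Sum>i\<in>{1..m}. c i l) * M l (\<sigma> u)) = (\<Sum>i\<in>{1..m}. \<Sum>l\<in>R. c i l * M l (\<sigma> u))"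
        by (subst sum.swap) (simp add: sum_distrib_right)
      also have "\<dots> = (\<Sum>i\<in>{1..m}. x (i, \<sigma> u))" by (rule sum.cong) (use c u in auto)
      also have "\<dots> = 0" using col u by simp
      finally show "(\<Sum>l\<in>R. (\<Sum>i\<in>{1..m}. c i l) * generic_matrix (gen_support n E) l (\<sigma> u)) = 0"
        by (simp add: M_def)
    qed (use \<sigma>(2) l in auto)
    have "c i l = 0" if i: "i \<in> {1..m}" and l: "l \<in> R" for i l
    proof (cases "fst l = i")
      case True
      \<comment> \<open>By \<open>off\<close>, row \<open>i\<close> alone contributes to the total
        coefficient of \<open>l\<close>.\<close>
      have "0 = (\<Sum>i'\<in>{1..m}. c i' l)" using total l by simp
      also have "\<dots> = (\<Sum>i'\<in>{1..m}. if i' = i then c i' l else 0)"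
        by (rule sum.cong) (use off l True in auto)
      finally show ?thesis using i by simp
    qed (use off i l in simp)
    then show "\<forall>p\<in>{1..m} \<times> {1..n}. x p = 0" using c by auto
  qed
qed

section \<open>Transfer to an arbitrary infinite type\<close>

lemma regular_imp_correctable:
  assumes inf: "infinite (UNIV :: 'a set)"
    and reg: "regular m n b E" and E: "E \<subseteq> {1..m} \<times> {1..n}" and b: "b \<le> n"
  shows "correctable TYPE('a) m n b E"
proof -
  \<comment> \<open>\<open>class_ring\<close> presents the type class field as a ring record, the
    form used by \<open>correctable\<close>.\<close>
  let ?K = "class_ring :: bit poly fract ring"
  have "(1::bit poly) + 1 = 0" by (simp flip: one_poly_def add: one_pCons)
  then have "(1::bit poly fract) + 1 = 0" by (metis to_fract_0 to_fract_1 to_fract_add)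
  then have K: "char2_field ?K"
    using class_field[where 'a = "bit poly fract"] by (simp add: char2_field_def)
  obtain \<beta> :: "nat \<Rightarrow> nat \<Rightarrow> bit poly fract" where \<beta>: "\<And>x. \<lbrakk>
    \<forall>j\<in>{1..n}. (\<Sum>i\<in>{1..m}. x (i, j)) = 0;
    \<forall>i\<in>{1..m}. \<forall>k\<in>{1..b}. (\<Sum>j\<in>{1..n}. \<beta> k j * x (i, j)) = 0;
    \<forall>p\<in>{1..m} \<times> {1..n} - E. x p = 0\<rbrakk> \<Longrightarrow> \<forall>p\<in>{1..m} \<times> {1..n}. x p = 0"
    using regular_imp_generic_code_corrects[OF reg E b, where 'a = bit] by blast
  have "corrects ?K m n (code ?K m n b (\<lambda>_. 1) \<beta>) E"
    unfolding corrects_def code_def using \<beta> by (auto simp: class_ring_simps)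
  moreover have "coefficients ?K m n b (\<lambda>_. 1) \<beta>" by (simp add: coefficients_def)
  ultimately have *: "correctable TYPE(bit poly fract) m n b E"
    using K unfolding correctable_def by blast
  have "(UNIV :: bit set) = {0, 1}" by auto
  then have "countable (UNIV :: bit set)" by (metis countable_finite finite.emptyI finite_insert)
  then obtain f :: "bit poly fract \<Rightarrow> nat" where "inj f"
    using countable_poly_fract by (metis countableE)
  moreover obtain g :: "nat \<Rightarrow> 'a" where "inj g"
    using inf infinite_countable_subset by blast
  ultimately have "inj (g \<circ> f)" by (simp add: inj_compose)
  then show ?thesis using * by (rule correctable_inj)
qed

section \<open>Necessity by counting equations\<close>

lemma (in abelian_monoid) finsum_swap:
  assumes "finite A" "finite B" "\<And>a b. a \<in> A \<Longrightarrow> b \<in> B \<Longrightarrow> f a b \<in> carrier G"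
  shows "(\<Oplus>a\<in>A. \<Oplus>b\<in>B. f a b) = (\<Oplus>b\<in>B. \<Oplus>a\<in>A. f a b)"
  using assms(1,3)
proof (induction A)
  case (insert a A)
  have "(\<Oplus>a\<in>insert a A. \<Oplus>b\<in>B. f a b) = (\<Oplus>b\<in>B. f a b) \<oplus> (\<Oplus>b\<in>B. \<Oplus>a\<in>A. f a b)"
    using insert by (simp add: finsum_insert Pi_def)
  also have "\<dots> = (\<Oplus>b\<in>B. f a b \<oplus> (\<Oplus>a\<in>A. f a b))"
    using insert by (subst finsum_addf) (auto simp: Pi_def)
  also have "\<dots> = (\<Oplus>b\<in>B. \<Oplus>a\<in>insert a A. f a b)"
    using insert by (intro finsum_cong') (auto simp: finsum_insert Pi_def)
  finally show ?case .
qed (use assms(2) in \<open>simp add: finsum_zero\<close>)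

text \<open>Gaussian elimination: a nonzero entry \<open>a q p\<close> eliminates the unknown
  \<open>p\<close> from the other equations, leaving one equation and one unknown fewer.\<close>

lemma (in field) homogeneous_system_solvable:
  assumes "finite Q" "finite Y" "card Q < card Y"
    and "\<And>q p. q \<in> Q \<Longrightarrow> p \<in> Y \<Longrightarrow> a q p \<in> carrier R"
  shows "\<exists>x. (\<forall>p\<in>Y. x p \<in> carrier R) \<and> (\<exists>p\<in>Y. x p \<noteq> \<zero>) \<and> (\<forall>q\<in>Q. (\<Oplus>p\<in>Y. a q p \<otimes> x p) = \<zero>)"
  using assms
proof (induction Q arbitrary: Y a rule: finite_induct)
  case empty
  then have "Y \<noteq> {}" by auto
  then show ?case by (intro exI[of _ "\<lambda>_. \<one>"]) auto
next
  case (insert q Q)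
  note a = insert.prems(3)
  show ?case
  proof (cases "\<forall>p\<in>Y. a q p = \<zero>")
    case True
    obtain x where x: "\<forall>p\<in>Y. x p \<in> carrier R" "\<exists>p\<in>Y. x p \<noteq> \<zero>" "\<forall>q\<in>Q. (\<Oplus>p\<in>Y. a q p \<otimes> x p) = \<zero>"
      using insert.IH[of Y a] insert.prems insert.hyps by auto
    have "(\<Oplus>p\<in>Y. a q p \<otimes> x p) = \<zero>"
      using True x by (intro add.finprod_one_eqI) auto
    then show ?thesis using x by (intro exI[of _ x]) auto
  next
    case False
    then obtain p where p: "p \<in> Y" "a q p \<noteq> \<zero>" by blast
    define t where "t = inv a q p"
    have t: "t \<in> carrier R" "a q p \<otimes> t = \<one>" using p a by (auto simp: t_def field_Units)
    define Z where "Z = Y - {p}"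
    have Z: "finite Z" "p \<notin> Z" "insert p Z = Y" using p insert.prems by (auto simp: Z_def)
    have aZ: "a q' y \<in> carrier R" if "q' \<in> insert q Q" "y \<in> Z" for q' y
      using that a by (simp add: Z_def)
    have ap: "a q' p \<in> carrier R" if "q' \<in> insert q Q" for q'
      using that a p by blast
    have "card Q < card Z" using insert Z by (metis Suc_less_eq card_insert_disjoint)
    then obtain x where x: "\<forall>y\<in>Z. x y \<in> carrier R" "\<exists>y\<in>Z. x y \<noteq> \<zero>"
      and eq: "\<forall>q'\<in>Q. (\<Oplus>y\<in>Z. (a q' y \<oplus> \<ominus> (a q' p \<otimes> t) \<otimes> a q y) \<otimes> x y) = \<zero>"
      using insert.IH[of Z "\<lambda>q' y. a q' y \<oplus> \<ominus> (a q' p \<otimes> t) \<otimes> a q y"] Z(1) aZ ap t by auto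
    define s where "s q' = (\<Oplus>y\<in>Z. a q' y \<otimes> x y)" for q'
    have s: "s q' \<in> carrier R" if "q' \<in> insert q Q" for q'
      unfolding s_def using aZ x that by (intro finsum_closed) auto
    \<comment> \<open>Back substitution: this value at \<open>p\<close> solves equation
      \<open>q\<close>. The other values are kept, so the solution stays nonzero.\<close>
    define x' where "x' = x(p := \<ominus> t \<otimes> s q)"
    have sum: "(\<Oplus>y\<in>Y. a q' y \<otimes> x' y) = a q' p \<otimes> (\<ominus> t \<otimes> s q) \<oplus> s q'" if q': "q' \<in> insert q Q" for q'
    proof -
      have "(\<Oplus>y\<in>Z. a q' y \<otimes> x' y) = s q'"
        unfolding s_def by (rule finsum_cong') (use Z aZ x q' in \<open>auto simp: x'_def\<close>)
      moreover have "x' y \<in> carrier R" if "y \<in> Z" for y using that x Z by (auto simp: x'_def)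
      ultimately show ?thesis
        unfolding Z(3)[symmetric] using Z aZ ap s t q'
        by (subst finsum_insert) (auto simp: x'_def)
    qed
    have "(\<Oplus>y\<in>Y. a q' y \<otimes> x' y) = \<zero>" if q': "q' \<in> insert q Q" for q'
    proof (cases "q' = q")
      case True
      have "a q p \<otimes> (t \<otimes> s q) = s q" using ap s t by (simp flip: m_assoc)
      then show ?thesis using sum[OF q'] True ap s t by (simp add: l_minus r_minus l_neg)
    next
      case False
      then have "q' \<in> Q" using q' by blast
      then have "\<zero> = (\<Oplus>y\<in>Z. (a q' y \<oplus> \<ominus> (a q' p \<otimes> t) \<otimes> a q y) \<otimes> x y)" using eq by simp
      also have "\<dots> = (\<Oplus>y\<in>Z. a q' y \<otimes> x y \<oplus> \<ominus> (a q' p \<otimes> t) \<otimes> (a q y \<otimes> x y))"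
        by (rule finsum_cong') (use aZ ap x t q' in \<open>auto simp: l_distr m_assoc\<close>)
      also have "\<dots> = s q' \<oplus> (\<Oplus>y\<in>Z. \<ominus> (a q' p \<otimes> t) \<otimes> (a q y \<otimes> x y))"
        unfolding s_def using aZ ap x t q' by (intro finsum_addf) auto
      also have "(\<Oplus>y\<in>Z. \<ominus> (a q' p \<otimes> t) \<otimes> (a q y \<otimes> x y)) = \<ominus> (a q' p \<otimes> t) \<otimes> s q"
        unfolding s_def using Z aZ ap x t q' by (intro finsum_rdistr[symmetric]) auto
      also have "\<dots> = a q' p \<otimes> (\<ominus> t \<otimes> s q)"
        using ap s t q' by (simp add: l_minus r_minus m_assoc)
      finally show ?thesis using sum[OF q'] ap s t q' by (simp add: a_comm)
    qed
    moreover have "\<forall>y\<in>Y. x' y \<in> carrier R" using x s t Z by (auto simp: x'_def)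
    moreover have "\<exists>y\<in>Y. x' y \<noteq> \<zero>" using x Z by (auto simp: x'_def)
    ultimately show ?thesis by blast
  qed
qed


text \<open>Otherwise a selection of the checks has fewer equations than there are erasures in
  \<open>U \<times> V\<close>. A nonzero solution, extended by zero, satisfies all checks and
  contradicts correction of \<open>E\<close>.\<close>

lemma card_corrected_le:
  assumes F: "field F" and co: "coefficients F m n b \<alpha> \<beta>"
    and cor: "corrects F m n (code F m n b \<alpha> \<beta>) E"
    and U: "U \<subseteq> {1..m}" "1 \<le> card U" and V: "V \<subseteq> {1..n}" "b \<le> card V"
  shows "card (E \<inter> U \<times> V) \<le> card V + card U * b - b"
proof (rule ccontr)
  assume "\<not> ?thesis"
  then have large: "card V + card U * b - b < card (E \<inter> U \<times> V)" by simp
  interpret F: field F by fact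
  define Y where "Y = E \<inter> U \<times> V"
  have fU: "finite U" and fV: "finite V" using U V finite_subset by blast+
  have Y: "finite Y" "Y \<subseteq> U \<times> V" using fU fV by (auto simp: Y_def intro: finite_subset)
  have \<alpha>: "\<alpha> i \<in> carrier F" if "i \<in> {1..m}" for i using co that by (simp add: coefficients_def)
  have \<beta>: "\<beta> k j \<in> carrier F" if "k \<in> {1..b}" "j \<in> {1..n}" for j k
    using co that by (simp add: coefficients_def)
  \<comment> \<open>The parity checks are linearly dependent on \<open>U \<times> V\<close>: if \<open>\<alpha> i \<noteq> 0\<close>, the checks of row \<open>i\<close>
    follow from the others, and if \<open>\<alpha>\<close> vanishes on \<open>U\<close>, the column checks are trivial.\<close>
  obtain U' V' where U': "U' \<subseteq> U" and V': "V' \<subseteq> V" and few: "card V' + card U' * b < card Y"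
    and cases: "(V' = V \<and> (\<exists>i0\<in>U. U' = U - {i0} \<and> \<alpha> i0 \<noteq> \<zero>\<^bsub>F\<^esub>)) \<or>
      (U' = U \<and> (\<forall>i\<in>U. \<alpha> i = \<zero>\<^bsub>F\<^esub>))"
  proof (cases "\<forall>i\<in>U. \<alpha> i = \<zero>\<^bsub>F\<^esub>")
    case True
    \<comment> \<open>Dropping the column checks saves \<open>card V\<close> equations, which is at
      least \<open>b\<close>.\<close>
    show ?thesis
      by (rule that[of U "{}"]) (use True large V in \<open>auto simp: Y_def\<close>)
  next
    case False
    then obtain i0 where i0: "i0 \<in> U" "\<alpha> i0 \<noteq> \<zero>\<^bsub>F\<^esub>" by blast
    have "card (U - {i0}) * b = card U * b - b" using i0 fU by (simp add: diff_mult_distrib)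
    then show ?thesis
      by (intro that[of "U - {i0}" V]) (use i0 large U in \<open>auto simp: Y_def\<close>)
  qed
  \<comment> \<open>\<open>Inl j\<close> stands for the check of column \<open>j\<close>,
    \<open>Inr (i, k)\<close> for the \<open>k\<close>-th check of row \<open>i\<close>; the
    unknowns are the cells of \<open>Y\<close>.\<close>
  define Q :: "(nat + nat \<times> nat) set" where "Q = V' <+> U' \<times> {1..b}"
  define a where "a q p = (case q of Inl j \<Rightarrow> if snd p = j then \<alpha> (fst p) else \<zero>\<^bsub>F\<^esub>
      | Inr (i, k) \<Rightarrow> if fst p = i then \<beta> k (snd p) else \<zero>\<^bsub>F\<^esub>)" for q :: "nat + nat \<times> nat" and p
  have f': "finite U'" "finite V'" using U' V' fU fV finite_subset by blast+
  have YD: "fst p \<in> {1..m}" "snd p \<in> {1..n}" if "p \<in> Y" for p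
  proof -
    have "p \<in> U \<times> V" using that Y by blast
    then show "fst p \<in> {1..m}" "snd p \<in> {1..n}" using U V by auto
  qed
  have "\<exists>x. (\<forall>p\<in>Y. x p \<in> carrier F) \<and> (\<exists>p\<in>Y. x p \<noteq> \<zero>\<^bsub>F\<^esub>) \<and>
      (\<forall>q\<in>Q. (\<Oplus>\<^bsub>F\<^esub>p\<in>Y. a q p \<otimes>\<^bsub>F\<^esub> x p) = \<zero>\<^bsub>F\<^esub>)"
  proof (rule F.homogeneous_system_solvable)
    show "card Q < card Y" using few f' by (simp add: Q_def card_Plus card_cartesian_product)
    show "a q p \<in> carrier F" if "q \<in> Q" "p \<in> Y" for q p
      using that YD[of p] \<alpha> \<beta> by (auto simp: a_def Q_def)
  qed (use f' Y in \<open>auto simp: Q_def\<close>)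
  then obtain x where x: "\<And>p. p \<in> Y \<Longrightarrow> x p \<in> carrier F" "\<exists>p\<in>Y. x p \<noteq> \<zero>\<^bsub>F\<^esub>"
    and eq: "\<And>q. q \<in> Q \<Longrightarrow> (\<Oplus>\<^bsub>F\<^esub>p\<in>Y. a q p \<otimes>\<^bsub>F\<^esub> x p) = \<zero>\<^bsub>F\<^esub>" by blast
  \<comment> \<open>Extension by zero off \<open>Y\<close>; \<open>restrict\<close> makes it
    extensional, as membership in \<open>code\<close> demands.\<close>
  define y where "y = restrict (\<lambda>p. if p \<in> Y then x p else \<zero>\<^bsub>F\<^esub>) ({1..m} \<times> {1..n})"
  have y: "y p \<in> carrier F" if "p \<in> {1..m} \<times> {1..n}" for p using that x by (auto simp: y_def)
  have y0: "y p = \<zero>\<^bsub>F\<^esub>" if "p \<in> {1..m} \<times> {1..n}" "p \<notin> Y" for p using that by (auto simp: y_def)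
  have yx: "y p = x p" if "p \<in> Y" for p using YD[OF that] that by (auto simp: y_def mem_Times_iff)
  have col_V': "(\<Oplus>\<^bsub>F\<^esub>i\<in>{1..m}. \<alpha> i \<otimes>\<^bsub>F\<^esub> y (i, j)) = \<zero>\<^bsub>F\<^esub>" if j: "j \<in> V'" for j
  proof -
    have jn: "j \<in> {1..n}" using j V' V by blast
    have "(\<Oplus>\<^bsub>F\<^esub>i\<in>{1..m}. \<alpha> i \<otimes>\<^bsub>F\<^esub> y (i, j)) = (\<Oplus>\<^bsub>F\<^esub>p\<in>(\<lambda>i. (i, j)) ` {1..m}. \<alpha> (fst p) \<otimes>\<^bsub>F\<^esub> y p)"
      by (subst F.finsum_reindex) (use \<alpha> y jn in \<open>auto simp: inj_on_def\<close>)
    also have "\<dots> = (\<Oplus>\<^bsub>F\<^esub>p\<in>Y. a (Inl j) p \<otimes>\<^bsub>F\<^esub> x p)"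
    proof (rule F.add.finprod_mono_neutral_cong)
      show "a (Inl j) p \<otimes>\<^bsub>F\<^esub> x p = \<zero>\<^bsub>F\<^esub>" if "p \<in> Y - (\<lambda>i. (i, j)) ` {1..m}" for p
      proof -
        have "snd p \<noteq> j" using that YD[of p] by (metis DiffD1 DiffD2 imageI prod.collapse)
        then show ?thesis using that x by (simp add: a_def)
      qed
      show "\<alpha> (fst p) \<otimes>\<^bsub>F\<^esub> y p = a (Inl j) p \<otimes>\<^bsub>F\<^esub> x p" if "p \<in> (\<lambda>i. (i, j)) ` {1..m} \<inter> Y" for p
        using that yx by (auto simp: a_def)
    qed (use Y \<alpha> y y0 x YD jn in \<open>auto simp: a_def\<close>)
    also have "\<dots> = \<zero>\<^bsub>F\<^esub>" by (rule eq) (use j in \<open>auto simp: Q_def\<close>)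
    finally show ?thesis .
  qed
  have row_U': "(\<Oplus>\<^bsub>F\<^esub>j\<in>{1..n}. \<beta> k j \<otimes>\<^bsub>F\<^esub> y (i, j)) = \<zero>\<^bsub>F\<^esub>" if i: "i \<in> U'" and k: "k \<in> {1..b}" for i k
  proof -
    have im: "i \<in> {1..m}" using i U' U by blast
    have "(\<Oplus>\<^bsub>F\<^esub>j\<in>{1..n}. \<beta> k j \<otimes>\<^bsub>F\<^esub> y (i, j)) = (\<Oplus>\<^bsub>F\<^esub>p\<in>Pair i ` {1..n}. \<beta> k (snd p) \<otimes>\<^bsub>F\<^esub> y p)"
      by (subst F.finsum_reindex) (use \<beta> y im k in \<open>auto simp: inj_on_def\<close>)
    also have "\<dots> = (\<Oplus>\<^bsub>F\<^esub>p\<in>Y. a (Inr (i, k)) p \<otimes>\<^bsub>F\<^esub> x p)"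
    proof (rule F.add.finprod_mono_neutral_cong)
      show "a (Inr (i, k)) p \<otimes>\<^bsub>F\<^esub> x p = \<zero>\<^bsub>F\<^esub>" if "p \<in> Y - Pair i ` {1..n}" for p
      proof -
        have "fst p \<noteq> i" using that YD[of p] by (metis DiffD1 DiffD2 imageI prod.collapse)
        then show ?thesis using that x by (simp add: a_def)
      qed
      show "\<beta> k (snd p) \<otimes>\<^bsub>F\<^esub> y p = a (Inr (i, k)) p \<otimes>\<^bsub>F\<^esub> x p" if "p \<in> Pair i ` {1..n} \<inter> Y" for p
        using that yx by (auto simp: a_def)
    qed (use Y \<beta> y y0 x YD im k in \<open>auto simp: a_def\<close>)
    also have "\<dots> = \<zero>\<^bsub>F\<^esub>" by (rule eq) (use i k in \<open>auto simp: Q_def\<close>)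
    finally show ?thesis .
  qed
  have col: "(\<Oplus>\<^bsub>F\<^esub>i\<in>{1..m}. \<alpha> i \<otimes>\<^bsub>F\<^esub> y (i, j)) = \<zero>\<^bsub>F\<^esub>" if j: "j \<in> {1..n}" for j
  proof (cases "j \<in> V'")
    case False
    \<comment> \<open>By \<open>cases\<close>, a cell of \<open>Y\<close> in a column outside
      \<open>V'\<close> occurs only if \<open>\<alpha>\<close> vanishes on \<open>U\<close>.\<close>
    have "\<alpha> i \<otimes>\<^bsub>F\<^esub> y (i, j) = \<zero>\<^bsub>F\<^esub>" if i: "i \<in> {1..m}" for i
    proof (cases "(i, j) \<in> Y")
      case True
      then have "\<alpha> i = \<zero>\<^bsub>F\<^esub>" using cases False Y by blast
      then show ?thesis using y i j by simp
    qed (use y0 \<alpha> i j in simp)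
    then show ?thesis by (intro F.add.finprod_one_eqI)
  qed (rule col_V')
  have row: "(\<Oplus>\<^bsub>F\<^esub>j\<in>{1..n}. \<beta> k j \<otimes>\<^bsub>F\<^esub> y (i, j)) = \<zero>\<^bsub>F\<^esub>" if i: "i \<in> {1..m}" and k: "k \<in> {1..b}" for i k
  proof -
    define \<rho> where "\<rho> i = (\<Oplus>\<^bsub>F\<^esub>j\<in>{1..n}. \<beta> k j \<otimes>\<^bsub>F\<^esub> y (i, j))" for i
    have \<rho>: "\<rho> i \<in> carrier F" if "i \<in> {1..m}" for i
      unfolding \<rho>_def using \<beta> y k that by (intro F.finsum_closed) auto
    have \<rho>0: "\<rho> i = \<zero>\<^bsub>F\<^esub>" if "i \<in> {1..m}" "i \<in> U' \<or> i \<notin> U" for i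
    proof (cases "i \<in> U'")
      case True
      then show ?thesis using row_U' k by (simp add: \<rho>_def)
    next
      case False
      then have "(i, j) \<notin> Y" for j using that Y by blast
      then show ?thesis unfolding \<rho>_def
        using that y0 \<beta> k by (intro F.add.finprod_one_eqI) auto
    qed
    have "\<rho> i = \<zero>\<^bsub>F\<^esub>"
    proof (cases "i \<in> U' \<or> i \<notin> U")
      case False
      then have \<alpha>i: "\<alpha> i \<noteq> \<zero>\<^bsub>F\<^esub>" and U'_eq: "U' = U - {i}" using cases by auto
      \<comment> \<open>Row \<open>i\<close> is the one whose checks were omitted. Weighting the
        \<open>k\<close>-th check of every row by \<open>\<alpha>\<close> and exchanging the sums
        yields a combination of column checks, hence zero, while all other rows contribute
        zero.\<close>
      have "\<alpha> i \<otimes>\<^bsub>F\<^esub> \<rho> i = (\<Oplus>\<^bsub>F\<^esub>i'\<in>{i}. \<alpha> i' \<otimes>\<^bsub>F\<^esub> \<rho> i')"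
        using \<alpha> \<rho> i by (simp add: F.finsum_insert)
      also have "\<dots> = (\<Oplus>\<^bsub>F\<^esub>i'\<in>{1..m}. \<alpha> i' \<otimes>\<^bsub>F\<^esub> \<rho> i')"
        by (rule F.add.finprod_mono_neutral_cong_left) (use \<alpha> \<rho> \<rho>0 i U'_eq in auto)
      also have "\<dots> = (\<Oplus>\<^bsub>F\<^esub>i'\<in>{1..m}. \<Oplus>\<^bsub>F\<^esub>j\<in>{1..n}. \<beta> k j \<otimes>\<^bsub>F\<^esub> (\<alpha> i' \<otimes>\<^bsub>F\<^esub> y (i', j)))"
      proof (rule F.finsum_cong')
        show "\<alpha> i' \<otimes>\<^bsub>F\<^esub> \<rho> i' = (\<Oplus>\<^bsub>F\<^esub>j\<in>{1..n}. \<beta> k j \<otimes>\<^bsub>F\<^esub> (\<alpha> i' \<otimes>\<^bsub>F\<^esub> y (i', j)))"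
          if i': "i' \<in> {1..m}" for i'
        proof -
          have "\<alpha> i' \<otimes>\<^bsub>F\<^esub> \<rho> i' = (\<Oplus>\<^bsub>F\<^esub>j\<in>{1..n}. \<alpha> i' \<otimes>\<^bsub>F\<^esub> (\<beta> k j \<otimes>\<^bsub>F\<^esub> y (i', j)))"
            unfolding \<rho>_def using \<alpha> \<beta> y i' k by (intro F.finsum_rdistr) auto
          also have "\<dots> = (\<Oplus>\<^bsub>F\<^esub>j\<in>{1..n}. \<beta> k j \<otimes>\<^bsub>F\<^esub> (\<alpha> i' \<otimes>\<^bsub>F\<^esub> y (i', j)))"
            by (rule F.finsum_cong') (use \<alpha> \<beta> y i' k in \<open>auto simp: F.m_lcomm\<close>)
          finally show ?thesis .
        qed
        show "(\<lambda>i'. \<Oplus>\<^bsub>F\<^esub>j\<in>{1..n}. \<beta> k j \<otimes>\<^bsub>F\<^esub> (\<alpha> i' \<otimes>\<^bsub>F\<^esub> y (i', j))) \<in> {1..m} \<rightarrow> carrier F"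
          using \<alpha> \<beta> y k by (intro Pi_I F.finsum_closed) auto
      qed simp
      also have "\<dots> = (\<Oplus>\<^bsub>F\<^esub>j\<in>{1..n}. \<Oplus>\<^bsub>F\<^esub>i'\<in>{1..m}. \<beta> k j \<otimes>\<^bsub>F\<^esub> (\<alpha> i' \<otimes>\<^bsub>F\<^esub> y (i', j)))"
        by (rule F.finsum_swap) (use \<alpha> \<beta> y k in auto)
      also have "\<dots> = \<zero>\<^bsub>F\<^esub>"
      proof (rule F.add.finprod_one_eqI)
        fix j assume j: "j \<in> {1..n}"
        have "(\<Oplus>\<^bsub>F\<^esub>i'\<in>{1..m}. \<beta> k j \<otimes>\<^bsub>F\<^esub> (\<alpha> i' \<otimes>\<^bsub>F\<^esub> y (i', j))) =
            \<beta> k j \<otimes>\<^bsub>F\<^esub> (\<Oplus>\<^bsub>F\<^esub>i'\<in>{1..m}. \<alpha> i' \<otimes>\<^bsub>F\<^esub> y (i', j))"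
          using \<alpha> \<beta> y j k by (intro F.finsum_rdistr[symmetric]) auto
        then show "(\<Oplus>\<^bsub>F\<^esub>i'\<in>{1..m}. \<beta> k j \<otimes>\<^bsub>F\<^esub> (\<alpha> i' \<otimes>\<^bsub>F\<^esub> y (i', j))) = \<zero>\<^bsub>F\<^esub>"
          using col[OF j] \<beta> j k by simp
      qed
      finally show ?thesis using \<alpha>i \<alpha> \<rho> i F.integral by blast
    qed (use \<rho>0 i in blast)
    then show ?thesis by (simp add: \<rho>_def)
  qed
  have "y \<in> code F m n b \<alpha> \<beta>"
    unfolding code_def using y row col by (auto simp: y_def)
  moreover have "\<forall>p\<in>{1..m} \<times> {1..n} - E. y p = \<zero>\<^bsub>F\<^esub>" using y0 by (auto simp: Y_def)
  ultimately have "\<forall>p\<in>{1..m} \<times> {1..n}. y p = \<zero>\<^bsub>F\<^esub>" using cor by (simp add: corrects_def)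
  then show False using x(2) yx YD by (metis mem_Times_iff)
qed

theorem theorem11:
  fixes m n b :: nat and E :: "(nat \<times> nat) set"
  assumes "infinite (UNIV :: 'a set)"
    and "2 \<le> m" and "m \<le> n"
    and "b \<le> n - 1"
    and "E \<subseteq> {1..m} \<times> {1..n}"
  shows "correctable TYPE('a) m n b E \<longleftrightarrow> regular m n b E"
proof
  assume "correctable TYPE('a) m n b E"
  then show "regular m n b E"
    unfolding correctable_def char2_field_def regular_def using card_corrected_le by blast
next
  assume "regular m n b E"
  then show "correctable TYPE('a) m n b E"
    by (rule regular_imp_correctable[OF assms(1)]) (use assms in auto)
qed

end
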